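(* Let $\mathbb{F}$ be an arbitrary field and let $P(\lambda)=\sum_{k=0}^dP_k\lambda^k\in\mathbb{F}[\lambda]^{n\times n}$ be a skew-symmetric matrix polynomial ($P_k^T=-P_k$ for all $k$) of odd degree $d$. Let $s=(d-1)/2$, let $\lambda B+A\in\mathbb{F}[\lambda]^{(s+1)n\times(s+1)n}$ be a pencil, and partition $A$ and $B$ into $n\times n$ blocks $A_{ij},B_{ij}$, $i,j=1,\dots,s+1$. Consider the system of equations $$\sum_{i+j=d+2-k}B_{ij}+\sum_{i+j=d+1-k}A_{ij}=P_k,\qquad k=0,1,\dots,d.\qquad( * )$$ Then the general skew-symmetric pencil solution $\lambda B+A$ (i.e. with $A^T=-A$, $B^T=-B$) of $( * )$ is obtained by letting the entries of the upper off-diagonal blocks $A_{ij},B_{ij}$, $i<j$, be free parameters, setting $A_{ji}=-A_{ij}^T$ and $B_{ji}=-B_{ij}^T$ for $i<j$, and setting, for $k=1,2,\dots,s+1$, $$B_{kk}=P_{d-2k+2}-\sum_{\substack{i+j=2k\\ i<j}}(B_{ij}-B_{ij}^T)-\sum_{\substack{i+j=2k-1\\ i<j}}(A_{ij}-A_{ij}^T),$$ $$A_{kk}=P_{d-2k+1}-\sum_{\substack{i+j=2k+1\\ i<j}}(B_{ij}-B_{ij}^T)-\sum_{\substack{i+j=2k\\ i<j}}(A_{ij}-A_{ij}^T).$$ That is, the skew-symmetric pencils satisfying $( * )$ are exactly the pencils of this form, for arbitrary choices of the blocks $A_{ij},B_{ij}\in\mathbb{F}^{n\times n}$ with $i<j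$.
   Context: All sums are over block indices $1\le i,j\le s+1$; empty sums are zero. A matrix $X$ is called skew-symmetric if $X^T=-X$. *)

theory Defs
  imports
    "HOL-Computational_Algebra.Polynomial"
    "Jordan_Normal_Form.Matrix"
begin

text \<open>
  A matrix polynomial is a matrix with polynomial entries; \<^term>\<open>poly_mat_coeff P k\<close> is the
  constant matrix \<open>P\<^sub>k\<close> in the expansion \<open>P(\<lambda>) = \<Sum> P\<^sub>k \<lambda>\<^sup>k\<close>.
\<close>

definition poly_mat_coeff :: "'a::zero poly mat \<Rightarrow> nat \<Rightarrow> 'a mat" where
  "poly_mat_coeff P k = map_mat (\<lambda>p. coeff p k) P"

text \<open>The degree of the zero (or empty) matrix polynomial is 0, as for \<^const>\<open>degree\<close>.\<close>

definition poly_mat_degree :: "'a::zero poly mat \<Rightarrow> nat" where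
  "poly_mat_degree P = Max (insert 0 (degree ` elements_mat P))"

text \<open>
  In characteristic 2 the following is just symmetry; no vanishing of the diagonal is required.
\<close>

definition skew_symmetric :: "'a::uminus mat \<Rightarrow> bool" where
  "skew_symmetric X \<longleftrightarrow> transpose_mat X = - X"

definition skew_symmetric_poly_mat :: "'a::{zero,uminus} poly mat \<Rightarrow> bool" where
  "skew_symmetric_poly_mat P \<longleftrightarrow> (\<forall>k. skew_symmetric (poly_mat_coeff P k))"

text \<open>
  A pencil \<open>L = \<lambda>B + A\<close> is a matrix polynomial of degree at most 1, so that
  \<open>A = poly_mat_coeff L 0\<close> and \<open>B = poly_mat_coeff L 1\<close>; \<open>B = 0\<close> is allowed.
\<close>

definition pencils :: "nat \<Rightarrow> 'a::zero poly mat set" where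
  "pencils N = {L \<in> carrier_mat N N. poly_mat_degree L \<le> 1}"

abbreviation pencil_A :: "'a::zero poly mat \<Rightarrow> 'a mat" where
  "pencil_A L \<equiv> poly_mat_coeff L 0"

abbreviation pencil_B :: "'a::zero poly mat \<Rightarrow> 'a mat" where
  "pencil_B L \<equiv> poly_mat_coeff L 1"

text \<open>
  The \<open>n \<times> n\<close> block in position \<open>(i, j)\<close>. Block indices start at 1, whereas the
  entries of a matrix are indexed from 0.
\<close>

definition block :: "nat \<Rightarrow> 'a mat \<Rightarrow> nat \<Rightarrow> nat \<Rightarrow> 'a mat" where
  "block n M i j = mat n n (\<lambda>(p, q). M $$ ((i - 1) * n + p, (j - 1) * n + q))"

text \<open>
  The sum of a finite family of \<open>n \<times> n\<close> matrices. It is taken entrywise because the type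
  \<^typ>\<open>'a mat\<close> has no zero element; the empty sum is the \<open>n \<times> n\<close> zero matrix.
\<close>

definition msum :: "nat \<Rightarrow> (nat \<times> nat \<Rightarrow> 'a::comm_monoid_add mat) \<Rightarrow> (nat \<times> nat) set \<Rightarrow> 'a mat" where
  "msum n f I = mat n n (\<lambda>pq. \<Sum>ij\<in>I. f ij $$ pq)"

definition antidiag :: "nat \<Rightarrow> nat \<Rightarrow> (nat \<times> nat) set" where
  "antidiag s m = {(i, j). i \<in> {1..s + 1} \<and> j \<in> {1..s + 1} \<and> i + j = m}"

definition upper_antidiag :: "nat \<Rightarrow> nat \<Rightarrow> (nat \<times> nat) set" where
  "upper_antidiag s m = {(i, j) \<in> antidiag s m. i < j}"

definition antidiag_system ::
  "nat \<Rightarrow> nat \<Rightarrow> nat \<Rightarrow> 'a::comm_monoid_add poly mat \<Rightarrow> 'a mat \<Rightarrow> 'a mat \<Rightarrow> bool" where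
  "antidiag_system n d s P A B \<longleftrightarrow>
     (\<forall>k\<in>{0..d}.
        msum n (\<lambda>(i, j). block n B i j) (antidiag s (d + 2 - k)) +
        msum n (\<lambda>(i, j). block n A i j) (antidiag s (d + 1 - k)) = poly_mat_coeff P k)"

text \<open>
  Choices of the free parameters: \<open>X i j\<close> is an arbitrary \<open>n \<times> n\<close> matrix for each
  \<open>1 \<le> i < j \<le> s + 1\<close>; the values at other index pairs are never used.
\<close>

definition upper_blocks :: "nat \<Rightarrow> nat \<Rightarrow> (nat \<Rightarrow> nat \<Rightarrow> 'a mat) set" where
  "upper_blocks n s = {X. \<forall>i j. 1 \<le> i \<and> i < j \<and> j \<le> s + 1 \<longrightarrow> X i j \<in> carrier_mat n n}"

text \<open>
  The matrices \<open>A\<close> and \<open>B\<close> are the ones given by the explicit formulas, where \<open>X i j\<close> and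
  \<open>Y i j\<close> (\<open>i < j\<close>) are the free parameters \<open>A\<^sub>i\<^sub>j\<close> and \<open>B\<^sub>i\<^sub>j\<close>. For odd \<open>d\<close> and
  \<open>s = (d - 1) div 2\<close>, no subtraction on the natural numbers truncates here, as \<open>2 * k \<le> d + 1\<close>.
\<close>

definition skew_solution_form ::
  "nat \<Rightarrow> nat \<Rightarrow> nat \<Rightarrow> 'a::ab_group_add poly mat \<Rightarrow> (nat \<Rightarrow> nat \<Rightarrow> 'a mat) \<Rightarrow> (nat \<Rightarrow> nat \<Rightarrow> 'a mat) \<Rightarrow>
   'a mat \<Rightarrow> 'a mat \<Rightarrow> bool" where
  "skew_solution_form n d s P X Y A B \<longleftrightarrow>
     (\<forall>i j. 1 \<le> i \<and> i < j \<and> j \<le> s + 1 \<longrightarrow>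
        block n A i j = X i j \<and> block n A j i = - transpose_mat (X i j) \<and>
        block n B i j = Y i j \<and> block n B j i = - transpose_mat (Y i j)) \<and>
     (\<forall>k\<in>{1..s + 1}.
        block n B k k = poly_mat_coeff P (d + 2 - 2 * k)
          - msum n (\<lambda>(i, j). Y i j - transpose_mat (Y i j)) (upper_antidiag s (2 * k))
          - msum n (\<lambda>(i, j). X i j - transpose_mat (X i j)) (upper_antidiag s (2 * k - 1)) \<and>
        block n A k k = poly_mat_coeff P (d + 1 - 2 * k)
          - msum n (\<lambda>(i, j). Y i j - transpose_mat (Y i j)) (upper_antidiag s (2 * k + 1))
          - msum n (\<lambda>(i, j). X i j - transpose_mat (X i j)) (upper_antidiag s (2 * k)))"

end

theory Submission
  imports Defs
begin

text \<open>
  For a skew-symmetric pencil the blocks \<open>(i, j)\<close> and \<open>(j, i)\<close> together contribute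
  \<open>M\<^sub>i\<^sub>j - M\<^sub>i\<^sub>j\<^sup>T\<close> to an antidiagonal sum. An antidiagonal \<open>i + j = m\<close> meets the diagonal
  exactly when \<open>m\<close> is even, and \<open>d\<close> is odd, so each equation of the system contains
  exactly one diagonal block, for which it can be solved. Conversely, those diagonal blocks are
  skew-symmetric as differences of a coefficient of \<open>P\<close> and sums of matrices \<open>X - X\<^sup>T\<close>.
\<close>

section \<open>Block matrices: entries, equality and assembly from blocks\<close>

lemma block_carrier [simp]: "block n M i j \<in> carrier_mat n n"
  and dim_row_block [simp]: "dim_row (block n M i j) = n"
  and dim_col_block [simp]: "dim_col (block n M i j) = n"
  by (auto simp: block_def)

lemma index_block [simp]:
  "p < n \<Longrightarrow> q < n \<Longrightarrow> block n M i j $$ (p, q) = M $$ ((i - 1) * n + p, (j - 1) * n + q)"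
  by (simp add: block_def)

lemma msum_carrier [simp]: "msum n f I \<in> carrier_mat n n"
  and dim_row_msum [simp]: "dim_row (msum n f I) = n"
  and dim_col_msum [simp]: "dim_col (msum n f I) = n"
  by (auto simp: msum_def)

lemma index_msum [simp]: "p < n \<Longrightarrow> q < n \<Longrightarrow> msum n f I $$ (p, q) = (\<Sum>ij\<in>I. f ij $$ (p, q))"
  by (simp add: msum_def)

lemma msum_cong: "(\<And>ij. ij \<in> I \<Longrightarrow> f ij = g ij) \<Longrightarrow> msum n f I = msum n g I"
  by (simp add: msum_def)

lemma block_index_less:
  fixes i n p s :: nat
  assumes "i \<in> {1..s + 1}" "p < n"
  shows "(i - 1) * n + p < (s + 1) * n"
proof -
  have "(i - 1) * n + p < (i - 1) * n + n" using assms by simp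
  also have "\<dots> = i * n" using assms by (cases i) auto
  also have "\<dots> \<le> (s + 1) * n" using assms by (intro mult_le_mono1) auto
  finally show ?thesis .
qed

text \<open>Division with remainder by \<open>n\<close>: the quotient gives the block, shifted by
  one since block indices start at 1, and the remainder gives the position inside it.\<close>

lemma block_index_cases:
  fixes a n s :: nat
  assumes "a < (s + 1) * n"
  obtains i p where "i \<in> {1..s + 1}" "p < n" "a = (i - 1) * n + p"
proof
  have "n > 0" using assms by (cases n) auto
  then show "a mod n < n" by simp
  have "a div n < s + 1" using assms by (simp add: less_mult_imp_div_less)
  then show "a div n + 1 \<in> {1..s + 1}" by simp
  show "a = (a div n + 1 - 1) * n + a mod n" by simp
qed

text \<open>By \<open>block_index_cases\<close> every entry lies in some block. This turns
  skew-symmetry and uniqueness into statements about single blocks.\<close>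

lemma mat_eq_iff_blocks:
  assumes "M \<in> carrier_mat ((s + 1) * n) ((s + 1) * n)"
    and "M' \<in> carrier_mat ((s + 1) * n) ((s + 1) * n)"
  shows "M = M' \<longleftrightarrow> (\<forall>i\<in>{1..s + 1}. \<forall>j\<in>{1..s + 1}. block n M i j = block n M' i j)"
proof (intro iffI eq_matI)
  fix a b
  assume eq: "\<forall>i\<in>{1..s + 1}. \<forall>j\<in>{1..s + 1}. block n M i j = block n M' i j"
    and "a < dim_row M'" "b < dim_col M'"
  then have ab: "a < (s + 1) * n" "b < (s + 1) * n" using assms by (simp_all only: carrier_matD)
  obtain i p where i: "i \<in> {1..s + 1}" "p < n" "a = (i - 1) * n + p"
    using ab(1) by (rule block_index_cases)
  obtain j q where j: "j \<in> {1..s + 1}" "q < n" "b = (j - 1) * n + q"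
    using ab(2) by (rule block_index_cases)
  have "block n M i j $$ (p, q) = block n M' i j $$ (p, q)" using eq i(1) j(1) by simp
  then show "M $$ (a, b) = M' $$ (a, b)" using i j by simp
qed (use assms in auto)

text \<open>Serves the existence half of the parametrisation: prescribed blocks can be glued into
  one matrix.\<close>

lemma exists_mat_of_blocks:
  assumes "\<And>i j. i \<in> {1..s + 1} \<Longrightarrow> j \<in> {1..s + 1} \<Longrightarrow> F i j \<in> carrier_mat n n"
  obtains M where "M \<in> carrier_mat ((s + 1) * n) ((s + 1) * n)"
    and "\<And>i j. i \<in> {1..s + 1} \<Longrightarrow> j \<in> {1..s + 1} \<Longrightarrow> block n M i j = F i j"
proof
  define N where "N = (s + 1) * n"
  \<comment> \<open>Quotient and remainder by \<open>n\<close> invert the indexing used in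
    \<open>block\<close>.\<close>
  define M where
    "M = mat N N (\<lambda>(a, b). F (a div n + 1) (b div n + 1) $$ (a mod n, b mod n))"
  show "M \<in> carrier_mat ((s + 1) * n) ((s + 1) * n)" by (simp add: M_def N_def)
  fix i j assume ij: "i \<in> {1..s + 1}" "j \<in> {1..s + 1}"
  show "block n M i j = F i j"
  proof (rule eq_matI)
    fix p q assume "p < dim_row (F i j)" "q < dim_col (F i j)"
    then have pq: "p < n" "q < n" using assms[OF ij] by auto
    have less: "(i - 1) * n + p < N" "(j - 1) * n + q < N"
      using ij pq by (auto simp only: N_def block_index_less)
    have "block n M i j $$ (p, q) =
        F (((i - 1) * n + p) div n + 1) (((j - 1) * n + q) div n + 1)
          $$ (((i - 1) * n + p) mod n, ((j - 1) * n + q) mod n)"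
      using less pq by (simp add: M_def)
    also have "\<dots> = F i j $$ (p, q)" using ij pq by simp
    finally show "block n M i j $$ (p, q) = F i j $$ (p, q)" .
  qed (use assms[OF ij] in auto)
qed

section \<open>Skew-symmetry read off from blocks\<close>

lemma skew_symmetric_index:
  assumes "X \<in> carrier_mat n n" "skew_symmetric X" "p < n" "q < n"
  shows "X $$ (q, p) = - X $$ (p, q)"
proof -
  have "transpose_mat X $$ (p, q) = (- X) $$ (p, q)"
    using assms by (simp add: skew_symmetric_def)
  then show ?thesis using assms by simp
qed

text \<open>Block \<open>(i, j)\<close> of the transpose is the transpose of block
  \<open>(j, i)\<close>, while negation acts on each block separately; comparing the blocks of
  \<open>transpose_mat M\<close> and \<open>- M\<close> gives the criterion.\<close>

lemma skew_symmetric_iff_blocks: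
  fixes M :: "'a::ab_group_add mat"
  assumes "M \<in> carrier_mat ((s + 1) * n) ((s + 1) * n)"
  shows "skew_symmetric M \<longleftrightarrow>
    (\<forall>i\<in>{1..s + 1}. \<forall>j\<in>{1..s + 1}. block n M j i = - transpose_mat (block n M i j))"
proof -
  have "block n (transpose_mat M) i j = block n (- M) i j \<longleftrightarrow>
      block n M j i = - transpose_mat (block n M i j)"
    if ij: "i \<in> {1..s + 1}" "j \<in> {1..s + 1}" for i j
  proof -
    have "block n (transpose_mat M) i j = transpose_mat (block n M j i)"
      using assms block_index_less[OF ij(1)] block_index_less[OF ij(2)]
      by (intro eq_matI) auto
    moreover have "block n (- M) i j = - block n M i j"
      using assms block_index_less[OF ij(1)] block_index_less[OF ij(2)]
      by (intro eq_matI) auto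
    \<comment> \<open>Transposition and negation are commuting involutions, so either equation
      yields the other.\<close>
    moreover have "transpose_mat (block n M j i) = - block n M i j \<longleftrightarrow>
        block n M j i = - transpose_mat (block n M i j)"
      by (metis transpose_transpose transpose_uminus)
    ultimately show ?thesis by simp
  qed
  then show ?thesis
    unfolding skew_symmetric_def
    by (subst mat_eq_iff_blocks[of _ s n]) (use assms in auto)
qed

lemma skew_symmetric_blockD:
  fixes M :: "'a::ab_group_add mat"
  assumes "M \<in> carrier_mat ((s + 1) * n) ((s + 1) * n)" "skew_symmetric M"
    and "i \<in> {1..s + 1}" "j \<in> {1..s + 1}"
  shows "block n M j i = - transpose_mat (block n M i j)"
  using assms(2-4) skew_symmetric_iff_blocks[OF assms(1)] by blast

text \<open>The condition \<open>i < j\<close> makes this usable as a rewrite rule: only strictly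
  lower blocks are replaced, whereas an unrestricted version would keep applying to its own
  result.\<close>

lemma index_block_skew:
  fixes M :: "'a::ab_group_add mat"
  assumes "M \<in> carrier_mat ((s + 1) * n) ((s + 1) * n)" "skew_symmetric M"
    and "1 \<le> i" "i < j" "j \<le> s + 1" "p < n" "q < n"
  shows "block n M j i $$ (p, q) = - block n M i j $$ (q, p)"
proof -
  have "block n M j i = - transpose_mat (block n M i j)"
    by (rule skew_symmetric_blockD[OF assms(1,2)]) (use assms(3-5) in auto)
  from arg_cong[OF this, of "\<lambda>Z. Z $$ (p, q)"] show ?thesis
    using assms(6,7) by (simp del: index_block)
qed

section \<open>Sums along antidiagonals\<close>

lemma finite_antidiag [simp]: "finite (antidiag s m)"
  by (rule finite_subset[of _ "{1..s + 1} \<times> {1..s + 1}"]) (auto simp: antidiag_def)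

lemma finite_upper_antidiag [simp]: "finite (upper_antidiag s m)"
  by (rule finite_subset[OF _ finite_antidiag[of s m]]) (auto simp: upper_antidiag_def)

lemma antidiag_off_diagonal:
  "{(i, j) \<in> antidiag s m. i \<noteq> j} = upper_antidiag s m \<union> prod.swap ` upper_antidiag s m"
  by (auto simp: upper_antidiag_def antidiag_def image_iff)

text \<open>Swapping \<open>i\<close> and \<open>j\<close> maps the part of the antidiagonal above
  the main diagonal bijectively onto the part below it, so the terms can be paired.\<close>

lemma sum_antidiag_off_diagonal:
  fixes g :: "nat \<times> nat \<Rightarrow> 'a::comm_monoid_add"
  shows "sum g {(i, j) \<in> antidiag s m. i \<noteq> j} =
    (\<Sum>(i, j)\<in>upper_antidiag s m. g (i, j) + g (j, i))"
proof -
  have "sum g {(i, j) \<in> antidiag s m. i \<noteq> j} =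
      sum g (upper_antidiag s m) + sum g (prod.swap ` upper_antidiag s m)"
    unfolding antidiag_off_diagonal
    by (rule sum.union_disjoint) (simp_all, auto simp: upper_antidiag_def)
  also have "sum g (prod.swap ` upper_antidiag s m) =
      (\<Sum>(i, j)\<in>upper_antidiag s m. g (j, i))"
    by (subst sum.reindex) (auto intro!: sum.cong)
  finally show ?thesis by (simp add: sum.distrib case_prod_unfold)
qed

text \<open>A diagonal pair \<open>(i, i)\<close> would force \<open>m = 2 * i\<close>, so no term
  is left over after the pairing.\<close>

lemma sum_antidiag_odd:
  fixes g :: "nat \<times> nat \<Rightarrow> 'a::comm_monoid_add"
  assumes "odd m"
  shows "sum g (antidiag s m) = (\<Sum>(i, j)\<in>upper_antidiag s m. g (i, j) + g (j, i))"
proof -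
  have "antidiag s m = {(i, j) \<in> antidiag s m. i \<noteq> j}"
    using assms by (auto simp: antidiag_def)
  then show ?thesis using sum_antidiag_off_diagonal[of g s m] by simp
qed

text \<open>The range of \<open>k\<close> guarantees that \<open>(k, k)\<close> lies on the
  antidiagonal; it is the only unpaired position.\<close>

lemma sum_antidiag_even:
  fixes g :: "nat \<times> nat \<Rightarrow> 'a::comm_monoid_add"
  assumes "k \<in> {1..s + 1}"
  shows "sum g (antidiag s (2 * k)) =
    g (k, k) + (\<Sum>(i, j)\<in>upper_antidiag s (2 * k). g (i, j) + g (j, i))"
proof -
  have eq: "antidiag s (2 * k) = insert (k, k) {(i, j) \<in> antidiag s (2 * k). i \<noteq> j}"
    using assms by (auto simp: antidiag_def)
  have "finite {(i, j) \<in> antidiag s (2 * k). i \<noteq> j}"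
    by (rule finite_subset[OF _ finite_antidiag[of s "2 * k"]]) auto
  then have "sum g (insert (k, k) {(i, j) \<in> antidiag s (2 * k). i \<noteq> j}) =
      g (k, k) + sum g {(i, j) \<in> antidiag s (2 * k). i \<noteq> j}"
    by (intro sum.insert) auto
  then show ?thesis using eq sum_antidiag_off_diagonal[of g s "2 * k"] by simp
qed

text \<open>After the pairing, skew-symmetry replaces each lower block by the negative transpose of
  its mirror image, so the sum depends only on the blocks above the diagonal.\<close>

lemma msum_antidiag_odd:
  fixes M :: "'a::ab_group_add mat"
  assumes "M \<in> carrier_mat ((s + 1) * n) ((s + 1) * n)" "skew_symmetric M" "odd m"
  shows "msum n (\<lambda>(i, j). block n M i j) (antidiag s m) =
    msum n (\<lambda>(i, j). block n M i j - transpose_mat (block n M i j)) (upper_antidiag s m)"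
    (is "?L = ?R")
proof (rule eq_matI)
  fix p q assume "p < dim_row ?R" "q < dim_col ?R"
  then have pq: "p < n" "q < n" by auto
  have "?L $$ (p, q) = (\<Sum>(i, j)\<in>upper_antidiag s m.
      block n M i j $$ (p, q) + block n M j i $$ (p, q))"
    using pq sum_antidiag_odd[OF assms(3), of "\<lambda>(i, j). block n M i j $$ (p, q)" s]
    by (simp add: case_prod_unfold del: index_block)
  also have "\<dots> = ?R $$ (p, q)"
    using pq by (auto simp: index_block_skew[OF assms(1,2)] upper_antidiag_def antidiag_def
        simp del: index_block intro!: sum.cong)
  finally show "?L $$ (p, q) = ?R $$ (p, q)" .
qed auto

text \<open>Here the pairing leaves over one diagonal block, the unknown for which an equation of
  the system is solved.\<close>

lemma msum_antidiag_even:
  fixes M :: "'a::ab_group_add mat"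
  assumes "M \<in> carrier_mat ((s + 1) * n) ((s + 1) * n)" "skew_symmetric M" "k \<in> {1..s + 1}"
  shows "msum n (\<lambda>(i, j). block n M i j) (antidiag s (2 * k)) =
    block n M k k +
    msum n (\<lambda>(i, j). block n M i j - transpose_mat (block n M i j)) (upper_antidiag s (2 * k))"
    (is "?L = _ + ?R")
proof (rule eq_matI)
  fix p q assume "p < dim_row (block n M k k + ?R)" "q < dim_col (block n M k k + ?R)"
  then have pq: "p < n" "q < n" by auto
  have "?L $$ (p, q) = block n M k k $$ (p, q) + (\<Sum>(i, j)\<in>upper_antidiag s (2 * k).
      block n M i j $$ (p, q) + block n M j i $$ (p, q))"
    using pq sum_antidiag_even[OF assms(3), of "\<lambda>(i, j). block n M i j $$ (p, q)"]
    by (simp add: case_prod_unfold del: index_block)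
  also have "(\<Sum>(i, j)\<in>upper_antidiag s (2 * k).
      block n M i j $$ (p, q) + block n M j i $$ (p, q)) = ?R $$ (p, q)"
    using pq by (auto simp: index_block_skew[OF assms(1,2)] upper_antidiag_def antidiag_def
        simp del: index_block intro!: sum.cong)
  finally show "?L $$ (p, q) = (block n M k k + ?R) $$ (p, q)" using pq by simp
qed auto

section \<open>Solving each equation of the system for its diagonal block\<close>

text \<open>The two groupings match the two kinds of equations: the diagonal block \<open>D\<close>
  comes from the \<open>B\<close> sum for odd coefficient indices and from the \<open>A\<close> sum
  for even ones.\<close>

lemma mat_add_eq_iff_eq_diff:
  fixes D U V C :: "'a::ab_group_add mat"
  assumes "D \<in> carrier_mat n n" "U \<in> carrier_mat n n" "V \<in> carrier_mat n n" "C \<in> carrier_mat n n"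
  shows "D + U + V = C \<longleftrightarrow> D = C - U - V"
    and "V + (D + U) = C \<longleftrightarrow> D = C - V - U"
  using assms by (auto simp: mat_eq_iff algebra_simps)

lemma poly_mat_coeff_carrier [simp]:
  "P \<in> carrier_mat m n \<Longrightarrow> poly_mat_coeff P k \<in> carrier_mat m n"
  by (simp add: poly_mat_coeff_def)

text \<open>
  Odd coefficients of \<open>P\<close> determine the diagonal blocks of \<open>B\<close>, even ones those of \<open>A\<close>.
\<close>

lemma ball_atLeastAtMost_odd_iff:
  fixes d s :: nat
  assumes "d = 2 * s + 1"
  shows "(\<forall>k\<in>{0..d}. Q k) \<longleftrightarrow> (\<forall>k\<in>{1..s + 1}. Q (d + 2 - 2 * k) \<and> Q (d + 1 - 2 * k))"
proof (intro iffI ballI)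
  fix m assume H: "\<forall>k\<in>{1..s + 1}. Q (d + 2 - 2 * k) \<and> Q (d + 1 - 2 * k)" and m: "m \<in> {0..d}"
  \<comment> \<open>With \<open>t = m div 2\<close>, the diagonal index is
    \<open>k = s + 1 - t\<close>; then \<open>d + 1 - 2 * k = 2 * t\<close> and
    \<open>d + 2 - 2 * k = 2 * t + 1\<close>, one of which is \<open>m\<close>.\<close>
  have "s + 1 - m div 2 \<in> {1..s + 1}" using m assms by auto
  then have "Q (d + 2 - 2 * (s + 1 - m div 2)) \<and> Q (d + 1 - 2 * (s + 1 - m div 2))"
    using H by blast
  moreover have "m = d + 2 - 2 * (s + 1 - m div 2) \<or> m = d + 1 - 2 * (s + 1 - m div 2)"
    using m assms by auto
  ultimately show "Q m" by metis
qed (use assms in auto)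

text \<open>With the blocks of \<open>A\<close> and \<open>B\<close> themselves as parameters, the
  off-diagonal clauses of the form are just skew-symmetry, so only the diagonal formulas have to be
  compared with the system.\<close>

lemma antidiag_system_iff:
  fixes A B :: "'a::ab_group_add mat"
  assumes P: "P \<in> carrier_mat n n" and d: "d = 2 * s + 1"
    and A: "A \<in> carrier_mat ((s + 1) * n) ((s + 1) * n)" "skew_symmetric A"
    and B: "B \<in> carrier_mat ((s + 1) * n) ((s + 1) * n)" "skew_symmetric B"
  shows "antidiag_system n d s P A B \<longleftrightarrow> skew_solution_form n d s P (block n A) (block n B) A B"
proof -
  have off: "block n M j i = - transpose_mat (block n M i j)"
    if "M = A \<or> M = B" "1 \<le> i \<and> i < j \<and> j \<le> s + 1" for M i j
    using that A B by (intro skew_symmetric_blockD) auto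
  define U where
    "U M m =
      msum n (\<lambda>(i, j). block n M i j - transpose_mat (block n M i j)) (upper_antidiag s m)"
    for M :: "'a mat" and m
  have U: "U M m \<in> carrier_mat n n" for M m by (simp add: U_def)
  have eqs: "(msum n (\<lambda>(i, j). block n B i j) (antidiag s (d + 2 - (d + 2 - 2 * k))) +
        msum n (\<lambda>(i, j). block n A i j) (antidiag s (d + 1 - (d + 2 - 2 * k))) =
        poly_mat_coeff P (d + 2 - 2 * k)) \<longleftrightarrow>
      block n B k k = poly_mat_coeff P (d + 2 - 2 * k) - U B (2 * k) - U A (2 * k - 1)"
    "(msum n (\<lambda>(i, j). block n B i j) (antidiag s (d + 2 - (d + 1 - 2 * k))) +
        msum n (\<lambda>(i, j). block n A i j) (antidiag s (d + 1 - (d + 1 - 2 * k))) =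
        poly_mat_coeff P (d + 1 - 2 * k)) \<longleftrightarrow>
      block n A k k = poly_mat_coeff P (d + 1 - 2 * k) - U B (2 * k + 1) - U A (2 * k)"
    if k: "k \<in> {1..s + 1}" for k
  proof -
    \<comment> \<open>Since \<open>1 \<le> k\<close> and \<open>2 * k \<le> d + 1\<close>, no
      subtraction truncates. The odd antidiagonal belongs to \<open>A\<close> in the first equation
      and to \<open>B\<close> in the second.\<close>
    have idx: "d + 2 - (d + 2 - 2 * k) = 2 * k" "d + 1 - (d + 2 - 2 * k) = 2 * k - 1"
      "d + 2 - (d + 1 - 2 * k) = 2 * k + 1" "d + 1 - (d + 1 - 2 * k) = 2 * k"
      "odd (2 * k - 1)" "odd (2 * k + 1)"
      using k d by auto
    note msums = msum_antidiag_even[OF A k, folded U_def] msum_antidiag_even[OF B k, folded U_def]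
      msum_antidiag_odd[OF A idx(5), folded U_def] msum_antidiag_odd[OF B idx(6), folded U_def]
    show "(msum n (\<lambda>(i, j). block n B i j) (antidiag s (d + 2 - (d + 2 - 2 * k))) +
        msum n (\<lambda>(i, j). block n A i j) (antidiag s (d + 1 - (d + 2 - 2 * k))) =
        poly_mat_coeff P (d + 2 - 2 * k)) \<longleftrightarrow>
      block n B k k = poly_mat_coeff P (d + 2 - 2 * k) - U B (2 * k) - U A (2 * k - 1)"
      unfolding idx msums using P U by (intro mat_add_eq_iff_eq_diff(1)) auto
    show "(msum n (\<lambda>(i, j). block n B i j) (antidiag s (d + 2 - (d + 1 - 2 * k))) +
        msum n (\<lambda>(i, j). block n A i j) (antidiag s (d + 1 - (d + 1 - 2 * k))) =
        poly_mat_coeff P (d + 1 - 2 * k)) \<longleftrightarrow>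
      block n A k k = poly_mat_coeff P (d + 1 - 2 * k) - U B (2 * k + 1) - U A (2 * k)"
      unfolding idx msums using P U by (intro mat_add_eq_iff_eq_diff(2)) auto
  qed
  have "antidiag_system n d s P A B \<longleftrightarrow> (\<forall>k\<in>{1..s + 1}.
      block n B k k = poly_mat_coeff P (d + 2 - 2 * k) - U B (2 * k) - U A (2 * k - 1) \<and>
      block n A k k = poly_mat_coeff P (d + 1 - 2 * k) - U B (2 * k + 1) - U A (2 * k))"
    unfolding antidiag_system_def ball_atLeastAtMost_odd_iff[OF d] by (intro ball_cong refl) (simp only: eqs)
  then show ?thesis
    unfolding skew_solution_form_def U_def using off by blast
qed

section \<open>The explicit form: its skew-symmetry and the blocks it prescribes\<close>

text \<open>The form reads its parameters only above the diagonal, so \<open>X\<close> and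
  \<open>Y\<close> can later be exchanged for the block families of the two coefficient
  matrices.\<close>

lemma skew_solution_form_cong:
  assumes "\<And>i j. 1 \<le> i \<Longrightarrow> i < j \<Longrightarrow> j \<le> s + 1 \<Longrightarrow> X i j = X' i j \<and> Y i j = Y' i j"
  shows "skew_solution_form n d s P X Y A B \<longleftrightarrow> skew_solution_form n d s P X' Y' A B"
proof -
  have "msum n (\<lambda>(i, j). X i j - transpose_mat (X i j)) (upper_antidiag s m) =
      msum n (\<lambda>(i, j). X' i j - transpose_mat (X' i j)) (upper_antidiag s m)"
    "msum n (\<lambda>(i, j). Y i j - transpose_mat (Y i j)) (upper_antidiag s m) =
      msum n (\<lambda>(i, j). Y' i j - transpose_mat (Y' i j)) (upper_antidiag s m)" for m
    using assms by (auto intro!: msum_cong simp: upper_antidiag_def antidiag_def)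
  then show ?thesis
    unfolding skew_solution_form_def using assms by (auto simp del: One_nat_def)
qed

text \<open>Each summand \<open>X i j - transpose_mat (X i j)\<close> changes sign under
  transposition, in any characteristic.\<close>

lemma skew_symmetric_msum_upper:
  fixes X :: "nat \<Rightarrow> nat \<Rightarrow> 'a::ab_group_add mat"
  assumes "X \<in> upper_blocks n s"
  shows "skew_symmetric (msum n (\<lambda>(i, j). X i j - transpose_mat (X i j)) (upper_antidiag s m))"
proof -
  have X: "X i j \<in> carrier_mat n n" if "(i, j) \<in> upper_antidiag s m" for i j
    using assms that by (auto simp: upper_antidiag_def antidiag_def upper_blocks_def)
  show ?thesis unfolding skew_symmetric_def
  proof (rule eq_matI, goal_cases)
    case (1 p q)
    then have pq: "p < n" "q < n" by auto
    then show ?case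
      by (auto simp: sum_negf[symmetric] intro!: sum.cong dest!: X)
  qed auto
qed

lemma skew_symmetric_diff:
  fixes M M' :: "'a::ab_group_add mat"
  assumes "M \<in> carrier_mat n n" "M' \<in> carrier_mat n n" "skew_symmetric M" "skew_symmetric M'"
  shows "skew_symmetric (M - M')"
  unfolding skew_symmetric_def
proof (rule eq_matI)
  fix p q assume "p < dim_row (- (M - M'))" "q < dim_col (- (M - M'))"
  then have pq: "p < n" "q < n" using assms(2) by auto
  show "transpose_mat (M - M') $$ (p, q) = (- (M - M')) $$ (p, q)"
    using assms(1,2) pq skew_symmetric_index[OF assms(1,3) pq] skew_symmetric_index[OF assms(2,4) pq]
    by simp
qed (use assms(1,2) in auto)

text \<open>Off the diagonal the form has skew-symmetry built in. On the diagonal it is inherited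
  from the coefficients of \<open>P\<close> and the correction sums, since differences of
  skew-symmetric matrices are skew-symmetric.\<close>

lemma skew_symmetric_if_skew_solution_form:
  fixes A B :: "'a::ab_group_add mat"
  assumes P: "P \<in> carrier_mat n n" "skew_symmetric_poly_mat P"
    and X: "X \<in> upper_blocks n s" and Y: "Y \<in> upper_blocks n s"
    and A: "A \<in> carrier_mat ((s + 1) * n) ((s + 1) * n)"
    and B: "B \<in> carrier_mat ((s + 1) * n) ((s + 1) * n)"
    and form: "skew_solution_form n d s P X Y A B"
  shows "skew_symmetric A" "skew_symmetric B"
proof -
  have Pk: "skew_symmetric (poly_mat_coeff P k)" for k
    using P(2) by (simp add: skew_symmetric_poly_mat_def)
  have diag: "block n M k k = - transpose_mat (block n M k k)"
    if "k \<in> {1..s + 1}" "M = A \<or> M = B" for M k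
  proof -
    have "skew_symmetric (block n M k k)"
      using form that P(1) Pk X Y unfolding skew_solution_form_def
      by (auto intro!: skew_symmetric_diff[of _ n] minus_carrier_mat skew_symmetric_msum_upper
          simp del: One_nat_def)
    then show ?thesis by (metis skew_symmetric_def uminus_uminus_mat)
  qed
  have off: "block n M j i = - transpose_mat (block n M i j)"
    "block n M i j = - transpose_mat (block n M j i)"
    if "1 \<le> i" "i < j" "j \<le> s + 1" "M = A \<or> M = B" for M i j
    using form that unfolding skew_solution_form_def
    by (auto simp: transpose_uminus simp del: One_nat_def)
  have "block n M j i = - transpose_mat (block n M i j)"
    if "i \<in> {1..s + 1}" "j \<in> {1..s + 1}" "M = A \<or> M = B" for M i j
  proof (cases i j rule: linorder_cases)
    case less
    with that show ?thesis by (intro off(1)) auto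
  next
    case equal
    with that diag show ?thesis by blast
  next
    case greater
    with that show ?thesis by (intro off(2)) auto
  qed
  then show "skew_symmetric A" "skew_symmetric B"
    using skew_symmetric_iff_blocks[OF A] skew_symmetric_iff_blocks[OF B] by blast+
qed

text \<open>For fixed \<open>X\<close> and \<open>Y\<close> the right-hand sides of the form do not
  involve \<open>A\<close> or \<open>B\<close>, so the form prescribes every block outright.
  Existence and uniqueness of the pencil then follow from gluing and blockwise comparison.\<close>

lemma skew_solution_form_obtain_blocks:
  fixes P :: "'a::ab_group_add poly mat"
  assumes P: "P \<in> carrier_mat n n"
    and X: "X \<in> upper_blocks n s" and Y: "Y \<in> upper_blocks n s"
  obtains F G where
    "\<And>i j. i \<in> {1..s + 1} \<Longrightarrow> j \<in> {1..s + 1} \<Longrightarrow> F i j \<in> carrier_mat n n"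
    "\<And>i j. i \<in> {1..s + 1} \<Longrightarrow> j \<in> {1..s + 1} \<Longrightarrow> G i j \<in> carrier_mat n n"
    "\<And>A B. skew_solution_form n d s P X Y A B \<longleftrightarrow>
       (\<forall>i\<in>{1..s + 1}. \<forall>j\<in>{1..s + 1}. block n A i j = F i j \<and> block n B i j = G i j)"
proof -
  define SX where
    "SX m = msum n (\<lambda>(i, j). X i j - transpose_mat (X i j)) (upper_antidiag s m)" for m
  define SY where
    "SY m = msum n (\<lambda>(i, j). Y i j - transpose_mat (Y i j)) (upper_antidiag s m)" for m
  define fill where "fill = (\<lambda>(D :: nat \<Rightarrow> 'a mat) Z i j.
    if i < j then Z i j else if j < i then - transpose_mat (Z j i) else D i)"
  define F where
    "F = fill (\<lambda>k. poly_mat_coeff P (d + 1 - 2 * k) - SY (2 * k + 1) - SX (2 * k)) X"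
  define G where
    "G = fill (\<lambda>k. poly_mat_coeff P (d + 2 - 2 * k) - SY (2 * k) - SX (2 * k - 1)) Y"
  have carrier: "F i j \<in> carrier_mat n n" "G i j \<in> carrier_mat n n"
    if "i \<in> {1..s + 1}" "j \<in> {1..s + 1}" for i j
    using that X Y by (auto simp: F_def G_def fill_def SX_def SY_def upper_blocks_def
        intro!: minus_carrier_mat)
  \<comment> \<open>Groups the block positions as the form does: mirrored off-diagonal pairs, then
    the diagonal.\<close>
  have all: "(\<forall>i\<in>{1..s + 1}. \<forall>j\<in>{1..s + 1}. R i j) \<longleftrightarrow>
      (\<forall>i j. 1 \<le> i \<and> i < j \<and> j \<le> s + 1 \<longrightarrow> R i j \<and> R j i) \<and> (\<forall>k\<in>{1..s + 1}. R k k)"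
    (is "?L \<longleftrightarrow> ?R") for R
  proof
    assume R: ?R
    have "R i j" if "i \<in> {1..s + 1}" "j \<in> {1..s + 1}" for i j
      using R that by (cases i j rule: linorder_cases) auto
    then show ?L by blast
  qed auto
  have "skew_solution_form n d s P X Y A B \<longleftrightarrow>
      (\<forall>i\<in>{1..s + 1}. \<forall>j\<in>{1..s + 1}. block n A i j = F i j \<and> block n B i j = G i j)" for A B
    unfolding all skew_solution_form_def SX_def[symmetric] SY_def[symmetric]
    by (auto simp: F_def G_def fill_def simp del: One_nat_def)
  with carrier show thesis by (rule that)
qed

section \<open>Pencils and their two coefficient matrices\<close>

lemma coeff_eq_0_if_poly_mat_degree_less:
  assumes "poly_mat_degree P < k" "a < dim_row P" "b < dim_col P"
  shows "coeff (P $$ (a, b)) k = 0"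
proof -
  \<comment> \<open>Finiteness of the set of entries is what makes \<open>Max\<close> an upper bound
    for their degrees.\<close>
  have "elements_mat P = (\<lambda>ij. P $$ ij) ` ({..<dim_row P} \<times> {..<dim_col P})"
    by (auto simp: elements_mat_def)
  then have "finite (elements_mat P)" by simp
  then have "degree (P $$ (a, b)) \<le> poly_mat_degree P"
    unfolding poly_mat_degree_def using assms by (intro Max_ge) auto
  then show ?thesis using assms by (intro coeff_eq_0) simp
qed

lemma pencil_eqI:
  assumes "L \<in> pencils N" "L' \<in> pencils N" "pencil_A L = pencil_A L'" "pencil_B L = pencil_B L'"
  shows "L = L'"
proof (rule eq_matI)
  have dims: "dim_row L = N" "dim_col L = N" "dim_row L' = N" "dim_col L' = N"
    and deg: "poly_mat_degree L \<le> 1" "poly_mat_degree L' \<le> 1"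
    using assms by (auto simp: pencils_def)
  fix a b assume "a < dim_row L'" "b < dim_col L'"
  then have ab: "a < N" "b < N" using dims by auto
  show "L $$ (a, b) = L' $$ (a, b)"
  proof (rule poly_eqI)
    fix k
    have "poly_mat_coeff L 0 $$ (a, b) = poly_mat_coeff L' 0 $$ (a, b)"
      "poly_mat_coeff L 1 $$ (a, b) = poly_mat_coeff L' 1 $$ (a, b)" using assms by auto
    then have "k = 0 \<or> k = 1 \<Longrightarrow> coeff (L $$ (a, b)) k = coeff (L' $$ (a, b)) k"
      using ab dims by (auto simp: poly_mat_coeff_def)
    moreover have "k > 1 \<Longrightarrow> coeff (L $$ (a, b)) k = coeff (L' $$ (a, b)) k"
      using ab dims deg by (simp add: coeff_eq_0_if_poly_mat_degree_less)
    ultimately show "coeff (L $$ (a, b)) k = coeff (L' $$ (a, b)) k" by linarith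
  qed
qed (use assms in \<open>auto simp: pencils_def\<close>)

lemma exists_pencil:
  assumes "A \<in> carrier_mat N N" "B \<in> carrier_mat N N"
  obtains L where "L \<in> pencils N" "pencil_A L = A" "pencil_B L = B"
proof
  \<comment> \<open>Each entry is the polynomial with constant term from \<open>A\<close> and linear
    term from \<open>B\<close>; its degree is at most 1 even where \<open>B\<close>
    vanishes.\<close>
  define L where "L = mat N N (\<lambda>ij. [:A $$ ij, B $$ ij:])"
  have "elements_mat L \<subseteq> (\<lambda>ij. [:A $$ ij, B $$ ij:]) ` ({..<N} \<times> {..<N})"
    by (auto simp: elements_mat_def L_def)
  then have "finite (elements_mat L)" "\<forall>p\<in>elements_mat L. degree p \<le> 1"
    by (auto intro: finite_subset)
  then show "L \<in> pencils N" by (simp add: pencils_def poly_mat_degree_def L_def)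
  show "pencil_A L = A" "pencil_B L = B"
    using assms by (auto simp: poly_mat_coeff_def L_def)
qed

text \<open>The second conjunct expresses that the upper blocks are free: every choice is realised,
  and by only one pencil.\<close>

theorem theorem4p13:
  fixes P :: "'a::field poly mat" and n d s :: nat
  assumes "P \<in> carrier_mat n n"
    and "skew_symmetric_poly_mat P"
    and "poly_mat_degree P = d"
    and "odd d"
    and "s = (d - 1) div 2"
  shows "(\<forall>L \<in> pencils ((s + 1) * n).
            skew_symmetric (pencil_A L) \<and> skew_symmetric (pencil_B L) \<and>
            antidiag_system n d s P (pencil_A L) (pencil_B L) \<longleftrightarrow>
            (\<exists>X \<in> upper_blocks n s. \<exists>Y \<in> upper_blocks n s.
               skew_solution_form n d s P X Y (pencil_A L) (pencil_B L))) \<and>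
         (\<forall>X \<in> upper_blocks n s. \<forall>Y \<in> upper_blocks n s.
            \<exists>!L. L \<in> pencils ((s + 1) * n) \<and>
                 skew_solution_form n d s P X Y (pencil_A L) (pencil_B L))"
proof (intro conjI ballI)
  have d: "d = 2 * s + 1" using assms(4,5) by (auto elim: oddE)
  have car: "poly_mat_coeff L k \<in> carrier_mat ((s + 1) * n) ((s + 1) * n)"
    if "L \<in> pencils ((s + 1) * n)" for L :: "'a poly mat" and k
    using that by (auto simp: pencils_def simp del: add_mult_distrib mult_Suc)
  {
    fix L :: "'a poly mat" assume L: "L \<in> pencils ((s + 1) * n)"
    note iff = antidiag_system_iff[OF assms(1) d car[OF L, of 0] _ car[OF L, of 1]]
    show "skew_symmetric (pencil_A L) \<and> skew_symmetric (pencil_B L) \<and>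
        antidiag_system n d s P (pencil_A L) (pencil_B L) \<longleftrightarrow>
        (\<exists>X \<in> upper_blocks n s. \<exists>Y \<in> upper_blocks n s.
           skew_solution_form n d s P X Y (pencil_A L) (pencil_B L))"
    proof (intro iffI; elim conjE bexE)
      assume "skew_symmetric (pencil_A L)" "skew_symmetric (pencil_B L)"
        "antidiag_system n d s P (pencil_A L) (pencil_B L)"
      then have "skew_solution_form n d s P (block n (pencil_A L)) (block n (pencil_B L))
          (pencil_A L) (pencil_B L)"
        using iff by blast
      moreover have "block n M \<in> upper_blocks n s" for M :: "'a mat"
        by (simp add: upper_blocks_def)
      ultimately show "\<exists>X \<in> upper_blocks n s. \<exists>Y \<in> upper_blocks n s.
          skew_solution_form n d s P X Y (pencil_A L) (pencil_B L)" by blast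
    next
      fix X Y assume XY: "X \<in> upper_blocks n s" "Y \<in> upper_blocks n s"
        and form: "skew_solution_form n d s P X Y (pencil_A L) (pencil_B L)"
      have skew: "skew_symmetric (pencil_A L)" "skew_symmetric (pencil_B L)"
        using skew_symmetric_if_skew_solution_form[OF assms(1,2) XY car[OF L] car[OF L] form] .
      \<comment> \<open>The form itself says that \<open>X\<close> and \<open>Y\<close> agree with
        the actual blocks above the diagonal, so they may be replaced and
        \<open>antidiag_system_iff\<close> applies.\<close>
      have "skew_solution_form n d s P (block n (pencil_A L)) (block n (pencil_B L))
          (pencil_A L) (pencil_B L)"
        using form
        by (subst skew_solution_form_cong[of s _ X _ Y])
          (simp_all add: skew_solution_form_def)
      with skew iff show "skew_symmetric (pencil_A L) \<and> skew_symmetric (pencil_B L) \<and>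
          antidiag_system n d s P (pencil_A L) (pencil_B L)" by blast
    qed
  }
  fix X Y :: "nat \<Rightarrow> nat \<Rightarrow> 'a mat"
  assume XY: "X \<in> upper_blocks n s" "Y \<in> upper_blocks n s"
  obtain F G where F: "\<And>i j. i \<in> {1..s + 1} \<Longrightarrow> j \<in> {1..s + 1} \<Longrightarrow> F i j \<in> carrier_mat n n"
    and G: "\<And>i j. i \<in> {1..s + 1} \<Longrightarrow> j \<in> {1..s + 1} \<Longrightarrow> G i j \<in> carrier_mat n n"
    and form: "\<And>A B. skew_solution_form n d s P X Y A B \<longleftrightarrow>
       (\<forall>i\<in>{1..s + 1}. \<forall>j\<in>{1..s + 1}. block n A i j = F i j \<and> block n B i j = G i j)"
    by (rule skew_solution_form_obtain_blocks[OF assms(1) XY, of d]) blast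
  obtain A where A: "A \<in> carrier_mat ((s + 1) * n) ((s + 1) * n)"
    "\<And>i j. i \<in> {1..s + 1} \<Longrightarrow> j \<in> {1..s + 1} \<Longrightarrow> block n A i j = F i j"
    by (rule exists_mat_of_blocks[of s F n]) (use F in blast)+
  obtain B where B: "B \<in> carrier_mat ((s + 1) * n) ((s + 1) * n)"
    "\<And>i j. i \<in> {1..s + 1} \<Longrightarrow> j \<in> {1..s + 1} \<Longrightarrow> block n B i j = G i j"
    by (rule exists_mat_of_blocks[of s G n]) (use G in blast)+
  obtain L where L: "L \<in> pencils ((s + 1) * n)" "pencil_A L = A" "pencil_B L = B"
    using A(1) B(1) by (rule exists_pencil)
  show "\<exists>!L. L \<in> pencils ((s + 1) * n) \<and>
      skew_solution_form n d s P X Y (pencil_A L) (pencil_B L)"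
  proof (intro ex1I[of _ L] conjI)
    show "skew_solution_form n d s P X Y (pencil_A L) (pencil_B L)"
      unfolding form using A B L by blast
    fix L' assume L': "L' \<in> pencils ((s + 1) * n) \<and>
      skew_solution_form n d s P X Y (pencil_A L') (pencil_B L')"
    \<comment> \<open>By \<open>form\<close>, the blocks of both coefficients of \<open>L'\<close>
      are those of \<open>F\<close> and \<open>G\<close>, hence agree with the blocks of
      \<open>A\<close> and \<open>B\<close>.\<close>
    then have "pencil_A L' = A" "pencil_B L' = B"
      using A B car[of L'] unfolding form
      by (simp_all add: mat_eq_iff_blocks[of _ s n] del: One_nat_def mult_Suc add_mult_distrib)
    then show "L' = L" using L L' by (intro pencil_eqI[of _ "(s + 1) * n"]) auto
  qed (rule L(1))
qed

end
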